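(* Let $X$ be a compact metric space, let $(B_{ss},\|\cdot\|_{ss})\subseteq (B_s,\|\cdot\|_s)\subseteq (B_w,\|\cdot\|_w)\subseteq(B_{ww},\|\cdot\|_{ww})$ be normed vector spaces of signed Borel measures on $X$ as described in the context, with zero-average subspaces $V_{ss},V_s,V_w,V_{ww}$, and let $\overline\delta>0$. Let $(L_\delta)_{\delta\in[0,\overline\delta)}$ be a family of bounded Markov operators $L_\delta:B_i\to B_i$, $i\in\{ss,s,w,ww\}$, satisfying the following. (LR1) For each $\delta\in[0,\overline\delta)$ there is a probability measure $h_\delta\in B_{ss}$ with $L_\delta h_\delta=h_\delta$. Furthermore there is $M\ge 0$ such that $\|h_\delta\|_{ss}\le M$ for each $\delta\in[0,\overline\delta)$. (LR2) There is a sequence $a_n\to 0$ such that for each $g\in V_{ss}$ and each $n$, $\|L_0^n g\|_s\le a_n\|g\|_{ss}$. (LR3) $(Id-L_0)^{-1}:=\sum_{i=0}^\infty L_0^i$ is a bounded operator $V_w\to V_w$. (LR4) There is $K\ge 0$ such that $\|L_0-L_\delta\|_{B_s\to B_w}\le K\delta$ and $\|L_0-L_\delta\|_{B_{ss}\to B_s}\le K\delta$ for all $\delta \in [0,\overline\delta)$. There is an element $\dot L h_0\in V_w$ such that $\lim_{\delta\to0}\left\|\frac{L_\delta-L_0}{\delta}h_0-\dot L h_0\right\|_w=0$. (QR1) The derivative operator $\dot L$ admits a bounded extension $\dot L:B_w\to V_{ww}$ (whose value at $h_0$ is the element $\dot Lh_0$ of (LR4)) such that $$\left\|\frac1\delta(L_\delta-L_0)-\dot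 L\right\|_{B_w\to B_{ww}}\xrightarrow[\delta\to0]{}0.$$ (QR2) There exists an element $\ddot L h_0\in V_{ww}$ such that $$\left\|\frac{(L_\delta-L_0)h_0-\delta\dot L h_0}{\delta^2}-\ddot L h_0\right\|_{ww}\xrightarrow[\delta\to0]{}0.$$ (QR3) The resolvent operator $(Id-L_0)^{-1}$ admits a bounded extension as an operator $V_{ww}\to V_{ww}$. Then the map $\delta\mapsto h_\delta\in B_{ss}$ has an order two Taylor expansion at $\delta=0$, in the sense that $$\left\|\frac{h_\delta-h_0-\delta(Id-L_0)^{-1}\dot Lh_0}{\delta^2}-(Id-L_0)^{-1}\left[\ddot Lh_0+\dot L(Id-L_0)^{-1}\dot Lh_0\right]\right\|_{ww}\xrightarrow[\delta\to0]{}0.$$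
   Context: $BS(X)$ denotes the space of signed Borel measures on the compact metric space $X$. The spaces $B_{ss}\subseteq B_s\subseteq B_w\subseteq B_{ww}\subseteq BS(X)$ are normed vector spaces with $\|\cdot\|_{ww}\le\|\cdot\|_w\le\|\cdot\|_s\le\|\cdot\|_{ss}$ (they may coincide), and the linear form $\mu\mapsto\mu(X)$ is assumed continuous on each $B_i$, $i\in\{ss,s,w,ww\}$. Put $V_i:=\{\mu\in B_i:\mu(X)=0\}$. A Markov operator is a linear operator $L$ preserving positive measures and such that $[L(\mu)](X)=\mu(X)$ for each positive measure $\mu$. For normed spaces $A,B$ and $T:A\to B$, $\|T\|_{A\to B}:=\sup_{f\in A,\|f\|_A\le1}\|Tf\|_B$. *)

theory Defs
  imports "HOL-Analysis.Analysis"
begin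

text \<open>
  Finite signed Borel measures, as countably additive real-valued set functions on the Borel
  sets. They are fixed to be 0 on non-Borel sets, so that equality in the type is equality of
  measures. Additivity is required of every enumeration of the sets, so the series converges
  unconditionally; the constant enumeration of the empty set gives \<open>m {} = 0\<close>.
\<close>

definition countably_additive_signed :: "('a::topological_space set \<Rightarrow> real) \<Rightarrow> bool" where
  "countably_additive_signed m \<longleftrightarrow>
     (\<forall>A. range A \<subseteq> sets borel \<longrightarrow> disjoint_family A \<longrightarrow> (\<lambda>i::nat. m (A i)) sums m (\<Union>i. A i))"

typedef (overloaded) ('a::topological_space) signed_measure =
  "{m :: 'a set \<Rightarrow> real. countably_additive_signed m \<and> (\<forall>A. A \<notin> sets borel \<longrightarrow> m A = 0)}"
  morphisms sm_measure Abs_signed_measure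
  by (rule exI[of _ "\<lambda>_. 0"]) (simp add: countably_additive_signed_def)

setup_lifting type_definition_signed_measure

instantiation signed_measure :: (topological_space) real_vector
begin

lift_definition zero_signed_measure :: "'a signed_measure" is "\<lambda>_. 0"
  by (simp add: countably_additive_signed_def)

lift_definition plus_signed_measure ::
  "'a signed_measure \<Rightarrow> 'a signed_measure \<Rightarrow> 'a signed_measure" is "\<lambda>m n A. m A + n A"
  by (auto simp: countably_additive_signed_def intro!: sums_add)

lift_definition minus_signed_measure ::
  "'a signed_measure \<Rightarrow> 'a signed_measure \<Rightarrow> 'a signed_measure" is "\<lambda>m n A. m A - n A"
  by (auto simp: countably_additive_signed_def intro!: sums_diff)

lift_definition uminus_signed_measure :: "'a signed_measure \<Rightarrow> 'a signed_measure"
  is "\<lambda>m A. - m A"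
  by (auto simp: countably_additive_signed_def intro!: sums_minus)

lift_definition scaleR_signed_measure :: "real \<Rightarrow> 'a signed_measure \<Rightarrow> 'a signed_measure"
  is "\<lambda>c m A. c * m A"
  by (auto simp: countably_additive_signed_def intro!: sums_mult)

instance
  by standard (transfer; simp add: algebra_simps)+

end

definition total_mass :: "'a::topological_space signed_measure \<Rightarrow> real" where
  "total_mass \<mu> = sm_measure \<mu> UNIV"

definition positive_sm :: "'a::topological_space signed_measure \<Rightarrow> bool" where
  "positive_sm \<mu> \<longleftrightarrow> (\<forall>A \<in> sets borel. 0 \<le> sm_measure \<mu> A)"

definition probability_sm :: "'a::topological_space signed_measure \<Rightarrow> bool" where
  "probability_sm \<mu> \<longleftrightarrow> positive_sm \<mu> \<and> total_mass \<mu> = 1"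

text \<open>
  Several norms live on different subspaces of the same space, so a normed space is a pair of a
  carrier \<open>V\<close> and a function \<open>N\<close>, of which only the values on \<open>V\<close> matter.
\<close>

definition norm_on :: "'v::real_vector set \<Rightarrow> ('v \<Rightarrow> real) \<Rightarrow> bool" where
  "norm_on V N \<longleftrightarrow> subspace V \<and>
     (\<forall>x\<in>V. 0 \<le> N x \<and> (N x = 0 \<longleftrightarrow> x = 0)) \<and>
     (\<forall>x\<in>V. \<forall>y\<in>V. N (x + y) \<le> N x + N y) \<and>
     (\<forall>c. \<forall>x\<in>V. N (c *\<^sub>R x) = \<bar>c\<bar> * N x)"

definition norm_continuous :: "'v::real_vector set \<Rightarrow> ('v \<Rightarrow> real) \<Rightarrow> ('v \<Rightarrow> real) \<Rightarrow> bool" where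
  "norm_continuous V N \<phi> \<longleftrightarrow>
     (\<forall>x\<in>V. \<forall>\<epsilon>>0. \<exists>\<eta>>0. \<forall>y\<in>V. N (y - x) < \<eta> \<longrightarrow> \<bar>\<phi> y - \<phi> x\<bar> < \<epsilon>)"

definition linear_between ::
  "'v::real_vector set \<Rightarrow> 'w::real_vector set \<Rightarrow> ('v \<Rightarrow> 'w) \<Rightarrow> bool" where
  "linear_between V W T \<longleftrightarrow> T ` V \<subseteq> W \<and>
     (\<forall>x\<in>V. \<forall>y\<in>V. T (x + y) = T x + T y) \<and>
     (\<forall>c. \<forall>x\<in>V. T (c *\<^sub>R x) = c *\<^sub>R T x)"

text \<open>
  The operator norm takes values in \<open>ereal\<close>, because the supremum of an unbounded set of reals
  is an unspecified real number.
\<close>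

definition op_norm ::
  "'v set \<Rightarrow> ('v \<Rightarrow> real) \<Rightarrow> ('w \<Rightarrow> real) \<Rightarrow> ('v \<Rightarrow> 'w) \<Rightarrow> ereal" where
  "op_norm V N N' T = (SUP f \<in> {f \<in> V. N f \<le> 1}. ereal (N' (T f)))"

definition bounded_operator ::
  "'v::real_vector set \<Rightarrow> ('v \<Rightarrow> real) \<Rightarrow> 'w::real_vector set \<Rightarrow> ('w \<Rightarrow> real) \<Rightarrow> ('v \<Rightarrow> 'w) \<Rightarrow> bool" where
  "bounded_operator V N W N' T \<longleftrightarrow> linear_between V W T \<and> op_norm V N N' T < \<infinity>"

definition markov_operator ::
  "'a::topological_space signed_measure set \<Rightarrow> ('a signed_measure \<Rightarrow> 'a signed_measure) \<Rightarrow> bool" where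
  "markov_operator B L \<longleftrightarrow> linear_between B B L \<and>
     (\<forall>\<mu>\<in>B. positive_sm \<mu> \<longrightarrow> positive_sm (L \<mu>) \<and> total_mass (L \<mu>) = total_mass \<mu>)"

definition zero_average ::
  "'a::topological_space signed_measure set \<Rightarrow> 'a signed_measure set" where
  "zero_average B = {\<mu> \<in> B. total_mass \<mu> = 0}"

text \<open>\<open>R v\<close> is the sum, in the norm \<open>N\<close>, of the series of the iterates \<open>L\<^sup>i v\<close>, for every \<open>v\<close> in \<open>V\<close>.\<close>

definition neumann_sum_on ::
  "'v::real_vector set \<Rightarrow> ('v \<Rightarrow> real) \<Rightarrow> ('v \<Rightarrow> 'v) \<Rightarrow> ('v \<Rightarrow> 'v) \<Rightarrow> bool" where
  "neumann_sum_on V N L R \<longleftrightarrow>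
     (\<forall>v\<in>V. (\<lambda>n. N ((\<Sum>i<n. (L ^^ i) v) - R v)) \<longlonglongrightarrow> 0)"

datatype space_index = i_ss | i_s | i_w | i_ww

definition nested_normed_spaces ::
  "(space_index \<Rightarrow> 'v::real_vector set) \<Rightarrow> (space_index \<Rightarrow> 'v \<Rightarrow> real) \<Rightarrow> bool" where
  "nested_normed_spaces B N \<longleftrightarrow>
     (\<forall>i. norm_on (B i) (N i)) \<and>
     B i_ss \<subseteq> B i_s \<and> B i_s \<subseteq> B i_w \<and> B i_w \<subseteq> B i_ww \<and>
     (\<forall>\<mu>\<in>B i_ss. N i_s \<mu> \<le> N i_ss \<mu>) \<and>
     (\<forall>\<mu>\<in>B i_s. N i_w \<mu> \<le> N i_s \<mu>) \<and>
     (\<forall>\<mu>\<in>B i_w. N i_ww \<mu> \<le> N i_w \<mu>)"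

end

theory Submission
  imports Defs
begin

text \<open>
  Everything rests on one identity. As \<open>h \<delta>\<close> and \<open>h 0\<close> are fixed by \<open>L \<delta>\<close> and \<open>L 0\<close>, the difference
  \<open>d = h \<delta> - h 0\<close> satisfies \<open>d - L 0 d = L \<delta> (h \<delta>) - L 0 (h \<delta>)\<close>. The iterates \<open>L 0\<^sup>n d\<close> vanish
  in the limit by (LR2), so the Neumann series inverts \<open>Id - L 0\<close> at \<open>d\<close>
  (lemma \<open>neumann_sum_inverts\<close>), and \<open>h \<delta> - h 0 = R (L \<delta> (h \<delta>) - L 0 (h \<delta>))\<close>.
  The expansion follows by improving the knowledge of \<open>d\<close> on the right-hand side three times.

  Order zero: \<open>d - L 0 d\<close> is \<open>O(\<delta>)\<close> in the strong norm, while \<open>L 0\<^sup>n d\<close> is small uniformly in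
  \<open>\<delta>\<close> for large \<open>n\<close>. Telescoping gives \<open>d \<rightarrow> 0\<close> in the strong norm
  (lemma \<open>almost_fixed_vectors_vanish\<close>).

  Order one: \<open>h \<delta> = h 0 + d\<close> splits \<open>(1 / \<delta>) (L \<delta> - L 0) (h \<delta>)\<close> into a part that tends to
  \<open>Ldot_h0\<close> and a part of weak norm at most \<open>K\<close> times the strong norm of \<open>d\<close>. Applying \<open>R\<close>,
  \<open>d / \<delta>\<close> tends to \<open>R Ldot_h0\<close> in the weak norm.

  Order two: the quotient \<open>(1 / \<delta>\<^sup>2) (d - \<delta> R Ldot_h0)\<close> is \<open>Rww\<close> applied to
  \<open>(1 / \<delta>\<^sup>2) ((L \<delta> - L 0) (h 0) - \<delta> Ldot_h0) + (1 / \<delta>) (L \<delta> - L 0) (d / \<delta>)\<close>.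
  The first summand tends to \<open>Lddot_h0\<close> by (QR2). In the second, operators that converge in
  operator norm are applied to the vectors \<open>d / \<delta>\<close>, which converge in the weak norm, so it tends
  to \<open>Ldot (R Ldot_h0)\<close> (lemma \<open>norm_tendsto_op_norm\<close>).

  The mass of \<open>L \<delta> \<mu>\<close> is known only for positive \<open>\<mu>\<close>, and the positive part of an element of one of
  the spaces may lie outside it. So \<open>L \<delta>\<close> is not known to preserve \<open>V i\<close>, and that the difference
  quotients of \<open>L\<close> fall into \<open>V i\<close> is derived from the positivity of \<open>h \<delta>\<close> and \<open>h 0\<close>.
\<close>

section \<open>Linear maps and norms on subspaces\<close>

lemma linear_between_simps:
  assumes "subspace A" "linear_between A C T" "x \<in> A"
  shows linear_between_mem: "T x \<in> C"
    and linear_between_zero: "T 0 = 0"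
    and linear_between_scaleR: "T (c *\<^sub>R x) = c *\<^sub>R T x"
    and linear_between_diff: "y \<in> A \<Longrightarrow> T (x - y) = T x - T y"
proof -
  show "T x \<in> C" and "T (c *\<^sub>R x) = c *\<^sub>R T x"
    using assms by (auto simp: linear_between_def)
  have "T (0 *\<^sub>R x) = 0 *\<^sub>R T x"
    using assms by (auto simp: linear_between_def simp del: scale_zero_left)
  then show "T 0 = 0" by simp
  show "T (x - y) = T x - T y" if "y \<in> A"
  proof -
    have neg: "(-1) *\<^sub>R y \<in> A" using subspace_scale[OF assms(1) that] .
    have "\<forall>x\<in>A. \<forall>y\<in>A. T (x + y) = T x + T y"
      using assms(2) by (simp add: linear_between_def)
    from bspec[OF bspec[OF this assms(3)] neg]
    have "T (x + (-1) *\<^sub>R y) = T x + T ((-1) *\<^sub>R y)" .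
    also have "T ((-1) *\<^sub>R y) = (-1) *\<^sub>R T y"
      using assms(2) that unfolding linear_between_def by blast
    finally show ?thesis by simp
  qed
qed

lemma linear_between_minus:
  assumes "subspace C" "linear_between A C S" "linear_between A C T"
  shows "linear_between A C (\<lambda>x. S x - T x)"
  using assms by (auto simp: linear_between_def algebra_simps intro: subspace_diff)

lemma linear_between_scale:
  assumes "subspace C" "linear_between A C T"
  shows "linear_between A C (\<lambda>x. c *\<^sub>R T x)"
  using assms by (auto simp: linear_between_def algebra_simps intro: subspace_scale)

lemma linear_between_codomain_mono:
  "linear_between A C T \<Longrightarrow> C \<subseteq> D \<Longrightarrow> linear_between A D T"
  by (auto simp: linear_between_def)

lemma norm_onD:
  assumes "norm_on V N"
  shows norm_on_subspace: "subspace V"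
    and norm_on_nonneg: "x \<in> V \<Longrightarrow> 0 \<le> N x"
    and norm_on_eq_0: "x \<in> V \<Longrightarrow> N x = 0 \<longleftrightarrow> x = 0"
    and norm_on_add: "x \<in> V \<Longrightarrow> y \<in> V \<Longrightarrow> N (x + y) \<le> N x + N y"
    and norm_on_scaleR: "x \<in> V \<Longrightarrow> N (c *\<^sub>R x) = \<bar>c\<bar> * N x"
  using assms by (auto simp: norm_on_def)

lemma norm_on_zero: "norm_on V N \<Longrightarrow> N 0 = 0"
  using norm_on_eq_0 norm_on_subspace subspace_0 by blast

lemma norm_on_minus_commute:
  assumes "norm_on V N" "x \<in> V" "y \<in> V"
  shows "N (x - y) = N (y - x)"
  using norm_on_scaleR[OF assms(1) subspace_diff[OF norm_on_subspace[OF assms(1)] assms(3,2)], of "-1"]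
  by simp

lemma norm_on_sum:
  assumes "norm_on V N" "finite I" "\<And>i. i \<in> I \<Longrightarrow> f i \<in> V"
  shows "N (\<Sum>i\<in>I. f i) \<le> (\<Sum>i\<in>I. N (f i))"
  using assms(2,3)
proof (induction I rule: finite_induct)
  case empty
  then show ?case using norm_on_zero[OF assms(1)] by simp
next
  case (insert i I)
  have "(\<Sum>i\<in>I. f i) \<in> V"
    using insert.prems by (intro subspace_sum norm_on_subspace[OF assms(1)]) auto
  then have "N (f i + (\<Sum>i\<in>I. f i)) \<le> N (f i) + N (\<Sum>i\<in>I. f i)"
    using insert.prems by (intro norm_on_add[OF assms(1)]) auto
  then show ?case using insert by force
qed

lemma norm_on_subset:
  assumes "norm_on V N" "subspace U" "U \<subseteq> V"
  shows "norm_on U N"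
  using assms unfolding norm_on_def by (simp add: subset_iff)

section \<open>Operator norms\<close>

lemma op_norm_le_imp_bound:
  assumes A: "norm_on A N" and C: "norm_on C N'" and T: "linear_between A C T"
    and le: "op_norm A N N' T \<le> ereal c" and x: "x \<in> A"
  shows "N' (T x) \<le> c * N x"
proof (cases "N x = 0")
  case True
  then have "x = 0" using norm_on_eq_0[OF A x] by simp
  then show ?thesis
    using linear_between_zero[OF norm_on_subspace[OF A] T x] norm_on_zero[OF C] True by simp
next
  case False
  then have pos: "0 < N x" using norm_on_nonneg[OF A x] by simp
  let ?y = "(1 / N x) *\<^sub>R x"
  have y: "?y \<in> A" using x norm_on_subspace[OF A] by (simp add: subspace_scale)
  have "N ?y = 1" using norm_on_scaleR[OF A x] pos by simp
  then have "ereal (N' (T ?y)) \<le> op_norm A N N' T"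
    unfolding op_norm_def using y by (intro SUP_upper) auto
  then have "N' (T ?y) \<le> c" using le order_trans ereal_less_eq(3) by blast
  moreover have "N' (T ?y) = (1 / N x) * N' (T x)"
    using linear_between_scaleR[OF norm_on_subspace[OF A] T x]
      norm_on_scaleR[OF C linear_between_mem[OF norm_on_subspace[OF A] T x]] pos by simp
  ultimately show ?thesis using pos by (simp add: field_simps)
qed

lemma bounded_operator_bound:
  assumes "norm_on A N" "norm_on C N'" "bounded_operator A N C N' T"
  obtains c where "0 \<le> c" "\<And>x. x \<in> A \<Longrightarrow> N' (T x) \<le> c * N x"
proof -
  have T: "linear_between A C T" and fin: "op_norm A N N' T < \<infinity>"
    using assms(3) by (auto simp: bounded_operator_def)
  obtain r where r: "op_norm A N N' T \<le> ereal r"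
    using fin by (cases "op_norm A N N' T") auto
  then have "op_norm A N N' T \<le> ereal (max r 0)"
    by (meson ereal_less_eq(3) max.cobounded1 order_trans)
  then show ?thesis using that[of "max r 0"] op_norm_le_imp_bound[OF assms(1,2) T] by simp
qed

lemma bounded_operator_linear: "bounded_operator A N C N' T \<Longrightarrow> linear_between A C T"
  by (simp add: bounded_operator_def)

section \<open>Convergence in the norm of a subspace\<close>

text \<open>
  Membership in the carrier is part of the notion, because the norm axioms hold only there.
\<close>

definition norm_tendsto ::
  "'v::real_vector set \<Rightarrow> ('v \<Rightarrow> real) \<Rightarrow> ('b \<Rightarrow> 'v) \<Rightarrow> 'v \<Rightarrow> 'b filter \<Rightarrow> bool" where
  "norm_tendsto V N f l F \<longleftrightarrow>
     l \<in> V \<and> (\<forall>\<^sub>F x in F. f x \<in> V) \<and> ((\<lambda>x. N (f x - l)) \<longlongrightarrow> 0) F"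

lemma norm_tendsto_cong:
  assumes "norm_tendsto V N f l F" "\<forall>\<^sub>F x in F. f x = g x"
  shows "norm_tendsto V N g l F"
proof -
  have "\<forall>\<^sub>F x in F. g x \<in> V"
    using assms unfolding norm_tendsto_def by (auto elim: eventually_elim2)
  moreover have "\<forall>\<^sub>F x in F. N (f x - l) = N (g x - l)"
    using assms(2) by (rule eventually_mono) simp
  ultimately show ?thesis
    using assms(1) unfolding norm_tendsto_def by (auto dest: tendsto_cong)
qed

lemma norm_tendsto_subset:
  assumes "norm_tendsto V N f l F" "l \<in> U" "\<forall>\<^sub>F x in F. f x \<in> U"
  shows "norm_tendsto U N f l F"
  using assms by (simp add: norm_tendsto_def)

lemma norm_tendsto_dominated:
  assumes V: "norm_on V N" and l: "l \<in> V" and f: "\<forall>\<^sub>F x in F. f x \<in> V"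
    and le: "\<forall>\<^sub>F x in F. N (f x - l) \<le> b x" and b: "(b \<longlongrightarrow> 0) F"
  shows "norm_tendsto V N f l F"
proof -
  have "\<forall>\<^sub>F x in F. 0 \<le> N (f x - l)"
    using f by (rule eventually_mono)
      (simp add: norm_on_nonneg[OF V] subspace_diff[OF norm_on_subspace[OF V]] l)
  then show ?thesis
    unfolding norm_tendsto_def using l f tendsto_sandwich[OF _ le tendsto_const b] by simp
qed

lemma norm_tendsto_add:
  assumes V: "norm_on V N" and f: "norm_tendsto V N f l F" and g: "norm_tendsto V N g m F"
  shows "norm_tendsto V N (\<lambda>x. f x + g x) (l + m) F"
proof (rule norm_tendsto_dominated[OF V])
  note sub = norm_on_subspace[OF V]
  have lm: "l \<in> V" "m \<in> V" and ev: "\<forall>\<^sub>F x in F. f x \<in> V \<and> g x \<in> V"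
    using f g unfolding norm_tendsto_def by (auto intro: eventually_conj)
  show "l + m \<in> V" using lm by (simp add: subspace_add sub)
  show "\<forall>\<^sub>F x in F. f x + g x \<in> V"
    using ev by (rule eventually_mono) (simp add: subspace_add sub)
  show "\<forall>\<^sub>F x in F. N (f x + g x - (l + m)) \<le> N (f x - l) + N (g x - m)"
    using ev
  proof (rule eventually_mono)
    fix x assume "f x \<in> V \<and> g x \<in> V"
    then have "N ((f x - l) + (g x - m)) \<le> N (f x - l) + N (g x - m)"
      using lm by (intro norm_on_add[OF V] subspace_diff[OF sub]) auto
    then show "N (f x + g x - (l + m)) \<le> N (f x - l) + N (g x - m)"
      by (simp add: algebra_simps)
  qed
  show "((\<lambda>x. N (f x - l) + N (g x - m)) \<longlongrightarrow> 0) F"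
    using f g unfolding norm_tendsto_def by (auto intro: tendsto_add_zero)
qed

lemma norm_tendsto_bounded_operator:
  assumes A: "norm_on A N" and C: "norm_on C N'" and T: "bounded_operator A N C N' T"
    and f: "norm_tendsto A N f l F"
  shows "norm_tendsto C N' (\<lambda>x. T (f x)) (T l) F"
proof -
  note sub = norm_on_subspace[OF A] and lin = bounded_operator_linear[OF T]
  obtain c where c: "\<And>x. x \<in> A \<Longrightarrow> N' (T x) \<le> c * N x"
    using bounded_operator_bound[OF A C T] by blast
  have l: "l \<in> A" and ev: "\<forall>\<^sub>F x in F. f x \<in> A" and lim: "((\<lambda>x. N (f x - l)) \<longlongrightarrow> 0) F"
    using f by (auto simp: norm_tendsto_def)
  show ?thesis
  proof (rule norm_tendsto_dominated[OF C])
    show "T l \<in> C" using linear_between_mem[OF sub lin l] .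
    show "\<forall>\<^sub>F x in F. T (f x) \<in> C"
      using ev by (rule eventually_mono) (rule linear_between_mem[OF sub lin])
    show "\<forall>\<^sub>F x in F. N' (T (f x) - T l) \<le> c * N (f x - l)"
      using ev
    proof (rule eventually_mono)
      fix x assume x: "f x \<in> A"
      show "N' (T (f x) - T l) \<le> c * N (f x - l)"
        using c[OF subspace_diff[OF sub x l]] linear_between_diff[OF sub lin x l] by simp
    qed
    show "((\<lambda>x. c * N (f x - l)) \<longlongrightarrow> 0) F"
      using tendsto_mult_left[OF lim, of c] by simp
  qed
qed

text \<open>
  Operators converging in operator norm may be applied to convergent vectors: split
  \<open>T x (f x) - S l\<close> as \<open>(T x - S) (f x) + S (f x - l)\<close>. The first summand is at most the operator
  norm times the norm of \<open>f x\<close>, which stays bounded.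
\<close>

lemma norm_tendsto_op_norm:
  assumes A: "norm_on A N" and C: "norm_on C N'"
    and T: "\<forall>\<^sub>F x in F. linear_between A C (T x)" and S: "bounded_operator A N C N' S"
    and lim: "((\<lambda>x. op_norm A N N' (\<lambda>v. T x v - S v)) \<longlongrightarrow> 0) F"
    and f: "norm_tendsto A N f l F"
  shows "norm_tendsto C N' (\<lambda>x. T x (f x)) (S l) F"
proof -
  note subA = norm_on_subspace[OF A] and subC = norm_on_subspace[OF C]
  have l: "l \<in> A" and fA: "\<forall>\<^sub>F x in F. f x \<in> A" and flim: "((\<lambda>x. N (f x - l)) \<longlongrightarrow> 0) F"
    using f by (auto simp: norm_tendsto_def)
  define r where "r = N l + 1"
  have r: "0 < r" using norm_on_nonneg[OF A l] by (simp add: r_def)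
  have bdd: "\<forall>\<^sub>F x in F. N (f x) \<le> r"
    using fA order_tendstoD(2)[OF flim zero_less_one]
  proof (rule eventually_elim2)
    fix x assume x: "f x \<in> A" "N (f x - l) < 1"
    have "N ((f x - l) + l) \<le> N (f x - l) + N l"
      using x l by (intro norm_on_add[OF A] subspace_diff[OF subA])
    then show "N (f x) \<le> r" using x(2) by (simp add: r_def)
  qed
  have ev: "\<forall>\<^sub>F x in F. T x (f x) - S (f x) \<in> C"
    using T fA
  proof (rule eventually_elim2)
    fix x assume x: "linear_between A C (T x)" "f x \<in> A"
    show "T x (f x) - S (f x) \<in> C"
      using linear_between_mem[OF subA x]
        linear_between_mem[OF subA bounded_operator_linear[OF S] x(2)]
      by (rule subspace_diff[OF subC])
  qed
  have diff: "norm_tendsto C N' (\<lambda>x. T x (f x) - S (f x)) 0 F"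
    unfolding norm_tendsto_def
  proof (intro conjI)
    show "0 \<in> C" by (rule subspace_0[OF subC])
    show "\<forall>\<^sub>F x in F. T x (f x) - S (f x) \<in> C" by (rule ev)
    show "((\<lambda>x. N' (T x (f x) - S (f x) - 0)) \<longlongrightarrow> 0) F"
    proof (rule tendstoI)
      fix e :: real assume e: "0 < e"
      have "\<forall>\<^sub>F x in F. op_norm A N N' (\<lambda>v. T x v - S v) < ereal (e / (2 * r))"
        using order_tendstoD(2)[OF lim] e r by (simp add: zero_ereal_def)
      then show "\<forall>\<^sub>F x in F. dist (N' (T x (f x) - S (f x) - 0)) 0 < e"
        using ev T fA bdd
      proof eventually_elim
        case (elim x)
        have "N' (T x (f x) - S (f x)) \<le> e / (2 * r) * N (f x)"
          using op_norm_le_imp_bound[OF A C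
            linear_between_minus[OF subC elim(3) bounded_operator_linear[OF S]]
            less_imp_le[OF elim(1)] elim(4)] .
        also have "\<dots> \<le> e / (2 * r) * r"
          using elim(5) e r by (intro mult_left_mono) auto
        also have "\<dots> < e" using e r by simp
        finally show ?case using norm_on_nonneg[OF C elim(2)] by simp
      qed
    qed
  qed
  show ?thesis
    using norm_tendsto_add[OF C diff norm_tendsto_bounded_operator[OF A C S f]] by simp
qed

section \<open>Iterates and the Neumann series\<close>

lemma linear_between_funpow_mem:
  assumes "linear_between A A L" "x \<in> A"
  shows "(L ^^ n) x \<in> A"
  using assms by (induction n) (auto simp: linear_between_def)

lemma linear_between_funpow_diff:
  assumes "subspace A" "linear_between A A L" "x \<in> A" "y \<in> A"
  shows "(L ^^ n) (x - y) = (L ^^ n) x - (L ^^ n) y"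
proof (induction n)
  case (Suc n)
  then show ?case
    using linear_between_diff[OF assms(1,2)] linear_between_funpow_mem[OF assms(2)] assms(3,4)
    by simp
qed simp

lemma sum_iterates_telescope:
  assumes "subspace A" "linear_between A A L" "x \<in> A"
  shows "(\<Sum>i<n. (L ^^ i) (x - L x)) = x - (L ^^ n) x"
proof -
  have "L x \<in> A" using linear_between_mem[OF assms] .
  then have "(L ^^ i) (x - L x) = (L ^^ i) x - (L ^^ Suc i) x" for i
    using linear_between_funpow_diff[OF assms(1-3), of "L x" i] by (simp add: funpow_swap1)
  then have "(\<Sum>i<n. (L ^^ i) (x - L x)) = (\<Sum>i<n. (L ^^ i) x - (L ^^ Suc i) x)"
    by (rule sum.cong[OF refl])
  also have "\<dots> = (L ^^ 0) x - (L ^^ n) x" by (rule sum_lessThan_telescope')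
  finally show ?thesis by simp
qed

text \<open>
  The partial sums of the Neumann series at \<open>d - L d\<close> telescope to \<open>d - L\<^sup>n d\<close>, which tends to \<open>d\<close>.
\<close>

lemma neumann_sum_inverts:
  assumes A: "norm_on A N" and VA: "V \<subseteq> A" and L: "linear_between A A L"
    and R: "neumann_sum_on V N L R" "R ` V \<subseteq> A"
    and d: "d \<in> A" "d - L d \<in> V" and lim: "(\<lambda>n. N ((L ^^ n) d)) \<longlonglongrightarrow> 0"
  shows "R (d - L d) = d"
proof -
  note sub = norm_on_subspace[OF A]
  let ?r = "R (d - L d)"
  have r: "?r \<in> A" using R(2) d(2) by auto
  have "(\<lambda>n. N (d - (L ^^ n) d - ?r)) \<longlonglongrightarrow> 0"
    using R(1) d(2) sum_iterates_telescope[OF sub L d(1)] by (auto simp: neumann_sum_on_def)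
  then have "(\<lambda>n. N (d - (L ^^ n) d - ?r) + N ((L ^^ n) d)) \<longlonglongrightarrow> 0"
    using tendsto_add[OF _ lim] by fastforce
  moreover have "N (d - ?r) \<le> N (d - (L ^^ n) d - ?r) + N ((L ^^ n) d)" for n
  proof -
    have "(L ^^ n) d \<in> A" using linear_between_funpow_mem[OF L d(1)] .
    then have "N ((d - (L ^^ n) d - ?r) + (L ^^ n) d) \<le> N (d - (L ^^ n) d - ?r) + N ((L ^^ n) d)"
      using r d(1) by (intro norm_on_add[OF A] subspace_diff[OF sub]) auto
    then show ?thesis by (simp add: algebra_simps)
  qed
  ultimately have "N (d - ?r) \<le> 0"
    by (intro LIMSEQ_le_const) auto
  moreover have dr: "d - ?r \<in> A" using d(1) r by (rule subspace_diff[OF sub])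
  ultimately show ?thesis
    using norm_on_nonneg[OF A dr] norm_on_eq_0[OF A dr] by simp
qed

text \<open>
  If the iterates of \<open>L\<close> send the vectors \<open>d x\<close> to zero uniformly in \<open>x\<close>, and \<open>d x\<close> is almost fixed
  by \<open>L\<close>, then \<open>d x\<close> is small: \<open>d x\<close> differs from \<open>L\<^sup>n (d x)\<close> by the \<open>n\<close> terms \<open>L\<^sup>i (d x - L (d x))\<close>.
  A fixed large \<open>n\<close> makes \<open>L\<^sup>n (d x)\<close> small, and then the \<open>n\<close> terms tend to zero. This is
  what makes the fixed points \<open>h \<delta>\<close> depend continuously on \<open>\<delta>\<close> at \<open>0\<close> in the strong norm.
\<close>

lemma almost_fixed_vectors_vanish:
  assumes A: "norm_on A N" and L: "bounded_operator A N A N L"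
    and d: "\<forall>\<^sub>F x in F. d x \<in> A"
    and contr: "\<forall>\<^sub>F x in F. \<forall>n. N ((L ^^ n) (d x)) \<le> b n" and b: "b \<longlonglongrightarrow> 0"
    and fixed: "((\<lambda>x. N (d x - L (d x))) \<longlongrightarrow> 0) F"
  shows "((\<lambda>x. N (d x)) \<longlongrightarrow> 0) F"
proof (rule tendstoI)
  note sub = norm_on_subspace[OF A] and lin = bounded_operator_linear[OF L]
  fix e :: real assume e: "0 < e"
  obtain c where c: "0 \<le> c" "\<And>x. x \<in> A \<Longrightarrow> N (L x) \<le> c * N x"
    using bounded_operator_bound[OF A A L] by blast
  have pow: "N ((L ^^ i) x) \<le> c ^ i * N x" if "x \<in> A" for i x
  proof (induction i)
    case (Suc i)
    have "N (L ((L ^^ i) x)) \<le> c * N ((L ^^ i) x)"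
      using c(2) linear_between_funpow_mem[OF lin that] by blast
    also have "\<dots> \<le> c * (c ^ i * N x)" using Suc c(1) by (rule mult_left_mono)
    finally show ?case by simp
  qed simp
  have "\<forall>\<^sub>F n in sequentially. b n < e / 2" using order_tendstoD(2)[OF b, of "e / 2"] e by simp
  then obtain n where n: "b n < e / 2" by (auto simp: eventually_sequentially)
  have "((\<lambda>x. (\<Sum>i<n. c ^ i) * N (d x - L (d x))) \<longlongrightarrow> 0) F"
    using tendsto_mult_left[OF fixed] by fastforce
  then have "\<forall>\<^sub>F x in F. (\<Sum>i<n. c ^ i) * N (d x - L (d x)) < e / 2"
    using order_tendstoD(2)[of _ 0 F "e / 2"] e by simp
  then show "\<forall>\<^sub>F x in F. dist (N (d x)) 0 < e"
    using d contr
  proof eventually_elim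
    case (elim x)
    let ?y = "d x - L (d x)"
    have y: "?y \<in> A" using elim(2) linear_between_mem[OF sub lin elim(2)]
      by (rule subspace_diff[OF sub])
    have mem: "(L ^^ i) ?y \<in> A" "(L ^^ i) (d x) \<in> A" for i
      using linear_between_funpow_mem[OF lin] y elim(2) by auto
    have "N (\<Sum>i<n. (L ^^ i) ?y) \<le> (\<Sum>i<n. N ((L ^^ i) ?y))"
      using mem by (intro norm_on_sum[OF A]) auto
    also have "\<dots> \<le> (\<Sum>i<n. c ^ i * N ?y)" using pow[OF y] by (intro sum_mono)
    also have "\<dots> < e / 2" using elim(1) by (simp add: sum_distrib_right)
    finally have small: "N (\<Sum>i<n. (L ^^ i) ?y) < e / 2" .
    have "d x = (\<Sum>i<n. (L ^^ i) ?y) + (L ^^ n) (d x)"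
      using sum_iterates_telescope[OF sub lin elim(2), of n] by simp
    then have "N (d x) \<le> N (\<Sum>i<n. (L ^^ i) ?y) + N ((L ^^ n) (d x))"
      using norm_on_add[OF A subspace_sum[OF sub, of "{..<n}" "\<lambda>i. (L ^^ i) ?y"] mem(2)] mem
      by metis
    also have "\<dots> < e" using small n spec[OF elim(3), of n] by linarith
    finally show ?case using norm_on_nonneg[OF A elim(2)] by simp
  qed
qed

section \<open>The total mass\<close>

lemma total_mass_linear [simp]:
  "total_mass 0 = 0"
  "total_mass (\<mu> + \<nu>) = total_mass \<mu> + total_mass \<nu>"
  "total_mass (\<mu> - \<nu>) = total_mass \<mu> - total_mass \<nu>"
  "total_mass (c *\<^sub>R \<mu>) = c * total_mass \<mu>"
  unfolding total_mass_def by (transfer; simp)+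

lemma subspace_zero_average: "subspace B \<Longrightarrow> subspace (zero_average B)"
  by (auto simp: subspace_def zero_average_def)

section \<open>The second-order response\<close>

theorem theorem7:
  fixes B :: "space_index \<Rightarrow> 'a::metric_space signed_measure set"
    and N :: "space_index \<Rightarrow> 'a signed_measure \<Rightarrow> real"
    and V :: "space_index \<Rightarrow> 'a signed_measure set"
    and L :: "real \<Rightarrow> 'a signed_measure \<Rightarrow> 'a signed_measure"
    and h :: "real \<Rightarrow> 'a signed_measure"
    and \<delta>0 :: real
    and R Rww Ldot :: "'a signed_measure \<Rightarrow> 'a signed_measure"
    and Ldot_h0 Lddot_h0 :: "'a signed_measure"
  assumes X: "compact (UNIV :: 'a set)"
    and spaces: "nested_normed_spaces B N"
    and mass_cont: "\<And>i. norm_continuous (B i) (N i) total_mass"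
    and V: "\<And>i. V i = zero_average (B i)"
    and \<delta>0: "\<delta>0 > 0"
    and L_markov: "\<And>\<delta> i. \<delta> \<in> {0..<\<delta>0} \<Longrightarrow> markov_operator (B i) (L \<delta>)"
    and L_bounded: "\<And>\<delta> i. \<delta> \<in> {0..<\<delta>0} \<Longrightarrow> bounded_operator (B i) (N i) (B i) (N i) (L \<delta>)"
    and LR1: "\<And>\<delta>. \<delta> \<in> {0..<\<delta>0} \<Longrightarrow> h \<delta> \<in> B i_ss \<and> probability_sm (h \<delta>) \<and> L \<delta> (h \<delta>) = h \<delta>"
      "\<exists>M\<ge>0. \<forall>\<delta>\<in>{0..<\<delta>0}. N i_ss (h \<delta>) \<le> M"
    and LR2: "\<exists>a :: nat \<Rightarrow> real. a \<longlonglongrightarrow> 0 \<and>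
      (\<forall>g\<in>V i_ss. \<forall>n. N i_s ((L 0 ^^ n) g) \<le> a n * N i_ss g)"
    and LR3: "neumann_sum_on (V i_w) (N i_w) (L 0) R"
      "bounded_operator (V i_w) (N i_w) (V i_w) (N i_w) R"
    and LR4: "\<exists>K\<ge>0. \<forall>\<delta>\<in>{0..<\<delta>0}.
        op_norm (B i_s) (N i_s) (N i_w) (\<lambda>f. L 0 f - L \<delta> f) \<le> ereal (K * \<delta>) \<and>
        op_norm (B i_ss) (N i_ss) (N i_s) (\<lambda>f. L 0 f - L \<delta> f) \<le> ereal (K * \<delta>)"
      "Ldot_h0 \<in> V i_w"
      "((\<lambda>\<delta>. N i_w ((1 / \<delta>) *\<^sub>R (L \<delta> (h 0) - L 0 (h 0)) - Ldot_h0)) \<longlongrightarrow> 0) (at_right 0)"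
    and QR1: "bounded_operator (B i_w) (N i_w) (V i_ww) (N i_ww) Ldot"
      "Ldot (h 0) = Ldot_h0"
      "((\<lambda>\<delta>. op_norm (B i_w) (N i_w) (N i_ww)
          (\<lambda>f. (1 / \<delta>) *\<^sub>R (L \<delta> f - L 0 f) - Ldot f)) \<longlongrightarrow> 0) (at_right 0)"
    and QR2: "Lddot_h0 \<in> V i_ww"
      "((\<lambda>\<delta>. N i_ww ((1 / \<delta>\<^sup>2) *\<^sub>R (L \<delta> (h 0) - L 0 (h 0) - \<delta> *\<^sub>R Ldot_h0) - Lddot_h0))
          \<longlongrightarrow> 0) (at_right 0)"
    and QR3: "bounded_operator (V i_ww) (N i_ww) (V i_ww) (N i_ww) Rww"
      "\<And>v. v \<in> V i_w \<Longrightarrow> Rww v = R v"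
  shows "((\<lambda>\<delta>. N i_ww ((1 / \<delta>\<^sup>2) *\<^sub>R (h \<delta> - h 0 - \<delta> *\<^sub>R R Ldot_h0)
            - Rww (Lddot_h0 + Ldot (R Ldot_h0)))) \<longlongrightarrow> 0) (at_right 0)"
proof -
  have NB: "norm_on (B i) (N i)" for i
    using spaces by (simp add: nested_normed_spaces_def)
  note sub = norm_on_subspace[OF NB]
  have incl: "B i_ss \<subseteq> B i_s" "B i_s \<subseteq> B i_w" "B i_w \<subseteq> B i_ww"
    and Nle: "\<And>\<mu>. \<mu> \<in> B i_ss \<Longrightarrow> N i_s \<mu> \<le> N i_ss \<mu>" "\<And>\<mu>. \<mu> \<in> B i_s \<Longrightarrow> N i_w \<mu> \<le> N i_s \<mu>"
    using spaces by (auto simp: nested_normed_spaces_def)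
  have incl_ss: "B i_ss \<subseteq> B i" for i using incl by (cases i) auto
  have VB: "V i \<subseteq> B i" and V_iff: "\<mu> \<in> V i \<longleftrightarrow> \<mu> \<in> B i \<and> total_mass \<mu> = 0" for i \<mu>
    by (auto simp: V zero_average_def)
  have NV: "norm_on (V i) (N i)" for i
    using norm_on_subset[OF NB _ VB] subspace_zero_average[OF sub] V by simp
  have lin: "linear_between (B i) (B i) (L \<delta>)" if "\<delta> \<in> {0..<\<delta>0}" for i \<delta>
    using L_markov[OF that] by (simp add: markov_operator_def)
  have zero: "0 \<in> {0..<\<delta>0}" using \<delta>0 by simp

  have h: "h \<delta> \<in> B i" "total_mass (h \<delta>) = 1" "L \<delta> (h \<delta>) = h \<delta>" "positive_sm (h \<delta>)"
    if "\<delta> \<in> {0..<\<delta>0}" for \<delta> i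
    using LR1(1)[OF that] incl_ss by (auto simp: probability_sm_def)
  have Lh: "L \<eta> (h \<delta>) \<in> B i" "total_mass (L \<eta> (h \<delta>)) = 1"
    if "\<eta> \<in> {0..<\<delta>0}" "\<delta> \<in> {0..<\<delta>0}" for \<eta> \<delta> i
    using L_markov[OF that(1), of i] linear_between_mem[OF sub lin[OF that(1)] h(1)[OF that(2)]]
      h[OF that(2)] by (auto simp: markov_operator_def)
  obtain M where M: "0 \<le> M" "\<And>\<delta>. \<delta> \<in> {0..<\<delta>0} \<Longrightarrow> N i_ss (h \<delta>) \<le> M"
    using LR1(2) by blast
  obtain K where K: "0 \<le> K"
    and K_op: "\<And>\<delta>. \<delta> \<in> {0..<\<delta>0} \<Longrightarrow>
        op_norm (B i_s) (N i_s) (N i_w) (\<lambda>f. L 0 f - L \<delta> f) \<le> ereal (K * \<delta>)"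
      "\<And>\<delta>. \<delta> \<in> {0..<\<delta>0} \<Longrightarrow>
        op_norm (B i_ss) (N i_ss) (N i_s) (\<lambda>f. L 0 f - L \<delta> f) \<le> ereal (K * \<delta>)"
    using LR4(1) by blast
  obtain a :: "nat \<Rightarrow> real" where a: "a \<longlonglongrightarrow> 0"
    "\<And>g n. g \<in> V i_ss \<Longrightarrow> N i_s ((L 0 ^^ n) g) \<le> a n * N i_ss g"
    using LR2 by blast
  have diff_lin: "linear_between (B i) (B i) (\<lambda>f. L 0 f - L \<delta> f)" if "\<delta> \<in> {0..<\<delta>0}" for \<delta> i
    using linear_between_minus[OF sub lin[OF zero] lin[OF that]] .
  have swap: "N i (L \<delta> x - L 0 x) = N i (L 0 x - L \<delta> x)" if "\<delta> \<in> {0..<\<delta>0}" "x \<in> B i" for \<delta> x i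
    using linear_between_mem[OF sub lin[OF that(1)] that(2)]
      linear_between_mem[OF sub lin[OF zero] that(2)] by (intro norm_on_minus_commute[OF NB])
  have K_s: "N i_w (L \<delta> x - L 0 x) \<le> K * \<delta> * N i_s x" if "\<delta> \<in> {0..<\<delta>0}" "x \<in> B i_s" for \<delta> x
    using op_norm_le_imp_bound[OF NB NB linear_between_codomain_mono[OF diff_lin[OF that(1)] incl(2)]
      K_op(1)[OF that(1)] that(2)] swap[OF that(1), of x i_w] that(2) incl(2) by auto
  have K_ss: "N i_s (L \<delta> x - L 0 x) \<le> K * \<delta> * N i_ss x" if "\<delta> \<in> {0..<\<delta>0}" "x \<in> B i_ss" for \<delta> x
    using op_norm_le_imp_bound[OF NB NB linear_between_codomain_mono[OF diff_lin[OF that(1)] incl(1)]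
      K_op(2)[OF that(1)] that(2)] swap[OF that(1), of x i_s] that(2) incl(1) by auto

  have range: "\<forall>\<^sub>F \<delta> in at_right 0. \<delta> \<in> {0..<\<delta>0} \<and> 0 < \<delta>"
    using eventually_at_right_real[OF \<delta>0] by (rule eventually_mono) auto

  define d where "d = (\<lambda>\<delta>. h \<delta> - h 0)"
  define E where "E = (\<lambda>\<delta> x. (1 / \<delta>) *\<^sub>R (L \<delta> x - L 0 x))"
  define u where "u = (\<lambda>\<delta>. (1 / \<delta>) *\<^sub>R d \<delta>)"

  have d_mem: "d \<delta> \<in> V i" if "\<delta> \<in> {0..<\<delta>0}" for \<delta> i
    using h[OF that] h[OF zero] subspace_diff[OF sub] by (simp add: V_iff d_def)
  have d_B: "d \<delta> \<in> B i" if "\<delta> \<in> {0..<\<delta>0}" for \<delta> i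
    using d_mem[OF that] VB by blast
  have d_fixed: "d \<delta> - L 0 (d \<delta>) = L \<delta> (h \<delta>) - L 0 (h \<delta>)" if "\<delta> \<in> {0..<\<delta>0}" for \<delta>
    using linear_between_diff[OF sub lin[OF zero] h(1)[OF that] h(1)[OF zero]] h(3)[OF that] h(3)[OF zero]
    by (simp add: d_def)
  have d_ss: "N i_ss (d \<delta>) \<le> 2 * M" if "\<delta> \<in> {0..<\<delta>0}" for \<delta>
  proof -
    have "N i_ss (h \<delta> + (-1) *\<^sub>R h 0) \<le> N i_ss (h \<delta>) + N i_ss ((-1) *\<^sub>R h 0)"
      using h(1)[OF that] h(1)[OF zero] by (intro norm_on_add[OF NB] subspace_scale[OF sub])
    then show ?thesis
      using norm_on_scaleR[OF NB h(1)[OF zero], of i_ss "-1"] M(2)[OF that] M(2)[OF zero]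
      by (simp add: d_def)
  qed
  have Eh_mem: "E \<delta> (h \<eta>) \<in> V i" if "\<delta> \<in> {0..<\<delta>0}" "\<eta> \<in> {0..<\<delta>0}" for \<delta> \<eta> i
    using Lh[OF that] Lh[OF zero that(2)] subspace_scale[OF sub] subspace_diff[OF sub]
    by (simp add: V_iff E_def)
  have E_lin: "linear_between (B i) (B i) (E \<delta>)" if "\<delta> \<in> {0..<\<delta>0}" for i \<delta>
    unfolding E_def
    using linear_between_scale[OF sub linear_between_minus[OF sub lin[OF that] lin[OF zero]]] .
  have Ed: "E \<delta> (d \<delta>) = E \<delta> (h \<delta>) - E \<delta> (h 0)" if "\<delta> \<in> {0..<\<delta>0}" for \<delta>
    unfolding d_def using linear_between_diff[OF sub E_lin[OF that] h(1)[OF that] h(1)[OF zero]] .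

  have d_inv: "d \<delta> = R (L \<delta> (h \<delta>) - L 0 (h \<delta>))" if "\<delta> \<in> {0..<\<delta>0}" for \<delta>
  proof -
    have "(\<lambda>n. N i_w ((L 0 ^^ n) (d \<delta>))) \<longlonglongrightarrow> 0"
    proof (rule tendsto_sandwich)
      have mem: "(L 0 ^^ n) (d \<delta>) \<in> B i" for n i
        using linear_between_funpow_mem[OF lin[OF zero] d_B[OF that]] .
      show "\<forall>\<^sub>F n in sequentially. 0 \<le> N i_w ((L 0 ^^ n) (d \<delta>))"
        using norm_on_nonneg[OF NB mem] by simp
      show "\<forall>\<^sub>F n in sequentially. N i_w ((L 0 ^^ n) (d \<delta>)) \<le> a n * N i_ss (d \<delta>)"
        using Nle(2)[OF mem] a(2)[OF d_mem[OF that]] order_trans by (intro always_eventually) blast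
      show "(\<lambda>n. a n * N i_ss (d \<delta>)) \<longlonglongrightarrow> 0"
        using tendsto_mult_right[OF a(1)] by fastforce
    qed simp
    moreover have "L \<delta> (h \<delta>) - L 0 (h \<delta>) \<in> V i_w"
      using Lh[OF that that] Lh[OF zero that] subspace_diff[OF sub] by (simp add: V_iff)
    moreover have "R ` V i_w \<subseteq> B i_w"
      using bounded_operator_linear[OF LR3(2)] VB by (auto simp: linear_between_def)
    ultimately show ?thesis
      using neumann_sum_inverts[OF NB VB lin[OF zero] LR3(1) _ d_B[OF that]] d_fixed[OF that] by simp
  qed
  have u_inv: "u \<delta> = R (E \<delta> (h \<delta>))" if "\<delta> \<in> {0..<\<delta>0}" for \<delta>
  proof -
    have "L \<delta> (h \<delta>) - L 0 (h \<delta>) \<in> V i_w"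
      using Lh[OF that that] Lh[OF zero that] subspace_diff[OF sub] by (simp add: V_iff)
    then show ?thesis
      using linear_between_scaleR[OF norm_on_subspace[OF NV] bounded_operator_linear[OF LR3(2)]]
        d_inv[OF that] by (simp add: u_def E_def)
  qed

  \<comment> \<open>Order zero: strong continuity of the fixed point.\<close>
  have d_tendsto: "((\<lambda>\<delta>. N i_s (d \<delta>)) \<longlongrightarrow> 0) (at_right 0)"
  proof (rule almost_fixed_vectors_vanish[OF NB L_bounded[OF zero]])
    show "\<forall>\<^sub>F \<delta> in at_right 0. d \<delta> \<in> B i_s"
      using range by (rule eventually_mono) (use d_B in blast)
    \<comment> \<open>The terms \<open>a n\<close> may be negative, hence the absolute value.\<close>
    show "\<forall>\<^sub>F \<delta> in at_right 0. \<forall>n. N i_s ((L 0 ^^ n) (d \<delta>)) \<le> \<bar>a n\<bar> * (2 * M)"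
      using range
    proof (rule eventually_mono, intro allI)
      fix \<delta> n assume "\<delta> \<in> {0..<\<delta>0} \<and> 0 < \<delta>"
      then have \<delta>: "\<delta> \<in> {0..<\<delta>0}" by simp
      have "N i_s ((L 0 ^^ n) (d \<delta>)) \<le> a n * N i_ss (d \<delta>)" using a(2)[OF d_mem[OF \<delta>]] .
      also have "\<dots> \<le> \<bar>a n\<bar> * (2 * M)"
        using d_ss[OF \<delta>] norm_on_nonneg[OF NB d_B[OF \<delta>]] by (intro mult_mono) auto
      finally show "N i_s ((L 0 ^^ n) (d \<delta>)) \<le> \<bar>a n\<bar> * (2 * M)" .
    qed
    show "(\<lambda>n. \<bar>a n\<bar> * (2 * M)) \<longlonglongrightarrow> 0"
      using tendsto_mult_left_zero[OF tendsto_rabs_zero[OF a(1)]] .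
    show "((\<lambda>\<delta>. N i_s (d \<delta> - L 0 (d \<delta>))) \<longlongrightarrow> 0) (at_right 0)"
    proof (rule tendsto_sandwich)
      show "\<forall>\<^sub>F \<delta> in at_right 0. 0 \<le> N i_s (d \<delta> - L 0 (d \<delta>))"
        using range
        by (rule eventually_mono)
          (use norm_on_nonneg[OF NB] subspace_diff[OF sub] d_B linear_between_mem[OF sub lin[OF zero]]
           in blast)
      show "\<forall>\<^sub>F \<delta> in at_right 0. N i_s (d \<delta> - L 0 (d \<delta>)) \<le> K * \<delta> * M"
        using range
      proof (rule eventually_mono)
        fix \<delta> :: real assume "\<delta> \<in> {0..<\<delta>0} \<and> 0 < \<delta>"
        then have \<delta>: "\<delta> \<in> {0..<\<delta>0}" "0 < \<delta>" by auto
        have "N i_s (d \<delta> - L 0 (d \<delta>)) \<le> K * \<delta> * N i_ss (h \<delta>)"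
          using K_ss[OF \<delta>(1) h(1)[OF \<delta>(1)]] d_fixed[OF \<delta>(1)] by simp
        also have "\<dots> \<le> K * \<delta> * M" using M(2)[OF \<delta>(1)] K \<delta>(2) by (intro mult_left_mono) auto
        finally show "N i_s (d \<delta> - L 0 (d \<delta>)) \<le> K * \<delta> * M" .
      qed
      show "((\<lambda>\<delta>. K * \<delta> * M) \<longlongrightarrow> 0) (at_right 0)"
        by (auto intro!: tendsto_eq_intros)
    qed simp
  qed

  \<comment> \<open>Order one: linear response in the weak norm.\<close>
  have "norm_tendsto (V i_w) (N i_w) (\<lambda>\<delta>. E \<delta> (h 0)) Ldot_h0 (at_right 0)"
    using LR4(2,3) range Eh_mem[OF _ zero] unfolding norm_tendsto_def E_def
    by (auto elim: eventually_mono)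
  moreover have "norm_tendsto (V i_w) (N i_w) (\<lambda>\<delta>. E \<delta> (d \<delta>)) 0 (at_right 0)"
  proof (rule norm_tendsto_dominated[OF NV])
    show "0 \<in> V i_w" using subspace_0[OF norm_on_subspace[OF NV]] .
    show "\<forall>\<^sub>F \<delta> in at_right 0. E \<delta> (d \<delta>) \<in> V i_w"
      using range
      by (rule eventually_mono) (use Ed Eh_mem zero subspace_diff[OF norm_on_subspace[OF NV]] in force)
    show "\<forall>\<^sub>F \<delta> in at_right 0. N i_w (E \<delta> (d \<delta>) - 0) \<le> K * N i_s (d \<delta>)"
      using range
    proof (rule eventually_mono)
      fix \<delta> :: real assume "\<delta> \<in> {0..<\<delta>0} \<and> 0 < \<delta>"
      then have \<delta>: "\<delta> \<in> {0..<\<delta>0}" "0 < \<delta>" by auto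
      have "L \<delta> (d \<delta>) - L 0 (d \<delta>) \<in> B i_w"
        using linear_between_mem[OF sub lin[OF \<delta>(1)] d_B[OF \<delta>(1)]]
          linear_between_mem[OF sub lin[OF zero] d_B[OF \<delta>(1)]] by (rule subspace_diff[OF sub])
      then have "N i_w (E \<delta> (d \<delta>)) = (1 / \<delta>) * N i_w (L \<delta> (d \<delta>) - L 0 (d \<delta>))"
        using norm_on_scaleR[OF NB] \<delta>(2) by (simp add: E_def)
      also have "\<dots> \<le> (1 / \<delta>) * (K * \<delta> * N i_s (d \<delta>))"
        using K_s[OF \<delta>(1) d_B[OF \<delta>(1)]] \<delta>(2) by (intro mult_left_mono) auto
      finally show "N i_w (E \<delta> (d \<delta>) - 0) \<le> K * N i_s (d \<delta>)" using \<delta>(2) by simp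
    qed
    show "((\<lambda>\<delta>. K * N i_s (d \<delta>)) \<longlongrightarrow> 0) (at_right 0)"
      using tendsto_mult_right_zero[OF d_tendsto] .
  qed
  ultimately have "norm_tendsto (V i_w) (N i_w) (\<lambda>\<delta>. E \<delta> (h 0) + E \<delta> (d \<delta>)) (Ldot_h0 + 0) (at_right 0)"
    by (rule norm_tendsto_add[OF NV])
  moreover have "\<forall>\<^sub>F \<delta> in at_right 0. E \<delta> (h 0) + E \<delta> (d \<delta>) = E \<delta> (h \<delta>)"
    using range by (rule eventually_mono) (simp add: Ed)
  ultimately have "norm_tendsto (V i_w) (N i_w) (\<lambda>\<delta>. E \<delta> (h \<delta>)) (Ldot_h0 + 0) (at_right 0)"
    by (rule norm_tendsto_cong)
  then have "norm_tendsto (V i_w) (N i_w) (\<lambda>\<delta>. R (E \<delta> (h \<delta>))) (R Ldot_h0) (at_right 0)"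
    using norm_tendsto_bounded_operator[OF NV NV LR3(2)] by simp
  moreover have "\<forall>\<^sub>F \<delta> in at_right 0. R (E \<delta> (h \<delta>)) = u \<delta>"
    using range by (rule eventually_mono) (simp add: u_inv)
  ultimately have u_V: "norm_tendsto (V i_w) (N i_w) u (R Ldot_h0) (at_right 0)"
    by (rule norm_tendsto_cong)
  then have u_tendsto: "norm_tendsto (B i_w) (N i_w) u (R Ldot_h0) (at_right 0)"
    using VB[of i_w] by (auto simp: norm_tendsto_def elim: eventually_mono)
  have RLdot: "R Ldot_h0 \<in> V i_w" using u_V by (simp add: norm_tendsto_def)

  \<comment> \<open>Order two, first summand: the second-order remainder of the operators at \<open>h 0\<close>.\<close>
  define p where "p = (\<lambda>\<delta>. (1 / \<delta>\<^sup>2) *\<^sub>R (L \<delta> (h 0) - L 0 (h 0) - \<delta> *\<^sub>R Ldot_h0))"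
  have Ldot_h0_ww: "Ldot_h0 \<in> V i_ww" using LR4(2) incl(3) by (auto simp: V_iff)
  have p_mem: "p \<delta> \<in> V i_ww" if "\<delta> \<in> {0..<\<delta>0}" for \<delta>
    using Lh[OF that zero] Lh[OF zero zero] Ldot_h0_ww subspace_scale[OF sub] subspace_diff[OF sub]
    by (simp add: V_iff p_def)
  have p_tendsto: "norm_tendsto (V i_ww) (N i_ww) p Lddot_h0 (at_right 0)"
    unfolding norm_tendsto_def
    using QR2 range p_mem by (auto simp: p_def elim: eventually_mono)

  \<comment> \<open>Order two, second summand: the difference quotients of the operators at \<open>u \<delta>\<close>.\<close>
  have Eu_mem: "E \<delta> (u \<delta>) \<in> V i_ww" if "\<delta> \<in> {0..<\<delta>0}" for \<delta>
  proof -
    have "E \<delta> (u \<delta>) = (1 / \<delta>) *\<^sub>R (E \<delta> (h \<delta>) - E \<delta> (h 0))"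
      using linear_between_scaleR[OF sub E_lin[OF that] d_B[OF that]] Ed[OF that] by (simp add: u_def)
    then show ?thesis
      using Eh_mem[OF that that] Eh_mem[OF that zero] norm_on_subspace[OF NV]
      by (simp add: subspace_scale subspace_diff)
  qed
  have Ldot_B: "bounded_operator (B i_w) (N i_w) (B i_ww) (N i_ww) Ldot"
    using QR1(1) linear_between_codomain_mono[OF _ VB] unfolding bounded_operator_def by blast
  have "norm_tendsto (B i_ww) (N i_ww) (\<lambda>\<delta>. E \<delta> (u \<delta>)) (Ldot (R Ldot_h0)) (at_right 0)"
  proof (rule norm_tendsto_op_norm[OF NB NB _ Ldot_B _ u_tendsto])
    show "\<forall>\<^sub>F \<delta> in at_right 0. linear_between (B i_w) (B i_ww) (E \<delta>)"
      using range
      by (rule eventually_mono) (use E_lin linear_between_codomain_mono incl(3) in blast)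
    show "((\<lambda>\<delta>. op_norm (B i_w) (N i_w) (N i_ww) (\<lambda>v. E \<delta> v - Ldot v)) \<longlongrightarrow> 0) (at_right 0)"
      using QR1(3) by (simp add: E_def)
  qed
  then have Eu_tendsto:
    "norm_tendsto (V i_ww) (N i_ww) (\<lambda>\<delta>. E \<delta> (u \<delta>)) (Ldot (R Ldot_h0)) (at_right 0)"
  proof (rule norm_tendsto_subset)
    have "R Ldot_h0 \<in> B i_w" using RLdot VB by blast
    then show "Ldot (R Ldot_h0) \<in> V i_ww"
      using linear_between_mem[OF sub bounded_operator_linear[OF QR1(1)]] by blast
    show "\<forall>\<^sub>F \<delta> in at_right 0. E \<delta> (u \<delta>) \<in> V i_ww"
      using range by (rule eventually_mono) (use Eu_mem in blast)
  qed

  have "norm_tendsto (V i_ww) (N i_ww) (\<lambda>\<delta>. Rww (p \<delta> + E \<delta> (u \<delta>)))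
      (Rww (Lddot_h0 + Ldot (R Ldot_h0))) (at_right 0)"
    using norm_tendsto_bounded_operator[OF NV NV QR3(1) norm_tendsto_add[OF NV p_tendsto Eu_tendsto]] .
  moreover have "\<forall>\<^sub>F \<delta> in at_right 0.
      Rww (p \<delta> + E \<delta> (u \<delta>)) = (1 / \<delta>\<^sup>2) *\<^sub>R (h \<delta> - h 0 - \<delta> *\<^sub>R R Ldot_h0)"
    using range
  proof (rule eventually_mono)
    fix \<delta> :: real assume "\<delta> \<in> {0..<\<delta>0} \<and> 0 < \<delta>"
    then have \<delta>: "\<delta> \<in> {0..<\<delta>0}" "0 < \<delta>" by auto
    note subV = norm_on_subspace[OF NV[of i_w]] and linR = bounded_operator_linear[OF LR3(2)]
    have E_w: "E \<delta> (h \<delta>) \<in> V i_w" using Eh_mem[OF \<delta>(1) \<delta>(1)] .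
    have diff_w: "E \<delta> (h \<delta>) - Ldot_h0 \<in> V i_w" using subspace_diff[OF subV E_w LR4(2)] .
    have "p \<delta> = (1 / \<delta>) *\<^sub>R (E \<delta> (h 0) - Ldot_h0)"
      using \<delta>(2) by (simp add: p_def E_def scaleR_right_diff_distrib power2_eq_square)
    moreover have "E \<delta> (u \<delta>) = (1 / \<delta>) *\<^sub>R (E \<delta> (h \<delta>) - E \<delta> (h 0))"
      using linear_between_scaleR[OF sub E_lin[OF \<delta>(1)] d_B[OF \<delta>(1)]] Ed[OF \<delta>(1)] by (simp add: u_def)
    moreover have "c *\<^sub>R (y - z) + c *\<^sub>R (x - y) = c *\<^sub>R (x - z)"
      for c and x y z :: "'a signed_measure"
      by (simp add: scaleR_right_diff_distrib)
    ultimately have "p \<delta> + E \<delta> (u \<delta>) = (1 / \<delta>) *\<^sub>R (E \<delta> (h \<delta>) - Ldot_h0)"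
      by (simp only:)
    then have "Rww (p \<delta> + E \<delta> (u \<delta>)) = R ((1 / \<delta>) *\<^sub>R (E \<delta> (h \<delta>) - Ldot_h0))"
      using QR3(2)[OF subspace_scale[OF subV diff_w]] by simp
    also have "\<dots> = (1 / \<delta>) *\<^sub>R (u \<delta> - R Ldot_h0)"
      using linear_between_scaleR[OF subV linR diff_w]
        linear_between_diff[OF subV linR E_w LR4(2)] u_inv[OF \<delta>(1)] by simp
    also have "\<dots> = (1 / \<delta>\<^sup>2) *\<^sub>R (h \<delta> - h 0 - \<delta> *\<^sub>R R Ldot_h0)"
      using \<delta>(2) by (simp add: u_def d_def scaleR_right_diff_distrib power2_eq_square)
    finally show "Rww (p \<delta> + E \<delta> (u \<delta>)) = (1 / \<delta>\<^sup>2) *\<^sub>R (h \<delta> - h 0 - \<delta> *\<^sub>R R Ldot_h0)" .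
  qed
  ultimately have "norm_tendsto (V i_ww) (N i_ww)
      (\<lambda>\<delta>. (1 / \<delta>\<^sup>2) *\<^sub>R (h \<delta> - h 0 - \<delta> *\<^sub>R R Ldot_h0))
      (Rww (Lddot_h0 + Ldot (R Ldot_h0))) (at_right 0)"
    by (rule norm_tendsto_cong)
  then show ?thesis by (simp only: norm_tendsto_def)
qed

end
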